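(* Every $1$-homogeneous isosceles-free metric space $X$ is ultrahomogeneous.
   Context: An isometry is a bijective distance-preserving map; $\operatorname{Aut}(X)$ is the group of all isometries $X\to X$. For $n\in\{1,2,3,\dots\}$, a metric space $X$ is $n$-homogeneous if for every isometry $f\colon A\to B$ between subspaces $A,B\subseteq X$ with $|A|\le n$ there exists $F\in\operatorname{Aut}(X)$ with $F|_A=f$. $X$ is ultrahomogeneous if it is $n$-homogeneous for every $n\ge 1$. A metric space $X$ is isosceles-free if $d(x,y)\neq d(x,z)$ for all pairwise distinct $x,y,z\in X$. *)

theory Defs
  imports "HOL-Analysis.Analysis"
begin

text \<open>
  Metric spaces are carrier-based: the space is a set \<open>M\<close> with a metric \<open>d\<close> on it,
  as in the library locale \<^locale>\<open>Metric_space\<close>; the empty space is included.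
\<close>

definition isometry :: "'a set \<Rightarrow> ('a \<Rightarrow> 'a \<Rightarrow> real) \<Rightarrow> 'b set \<Rightarrow> ('b \<Rightarrow> 'b \<Rightarrow> real) \<Rightarrow> ('a \<Rightarrow> 'b) \<Rightarrow> bool"
  where "isometry A d B e f \<longleftrightarrow>
    bij_betw f A B \<and> (\<forall>x\<in>A. \<forall>y\<in>A. e (f x) (f y) = d x y)"

text \<open>
  Functions are total in HOL, so a map \<open>M \<rightarrow> M\<close> is represented by the unique
  function that is \<^const>\<open>undefined\<close> outside of \<open>M\<close>.
\<close>

definition Aut :: "'a set \<Rightarrow> ('a \<Rightarrow> 'a \<Rightarrow> real) \<Rightarrow> ('a \<Rightarrow> 'a) set"
  where "Aut M d = {F \<in> extensional M. isometry M d M d F}"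

definition homogeneous :: "nat \<Rightarrow> 'a set \<Rightarrow> ('a \<Rightarrow> 'a \<Rightarrow> real) \<Rightarrow> bool"
  where "homogeneous n M d \<longleftrightarrow>
    (\<forall>A B f. A \<subseteq> M \<and> B \<subseteq> M \<and> finite A \<and> card A \<le> n \<and> isometry A d B d f \<longrightarrow>
      (\<exists>F\<in>Aut M d. \<forall>x\<in>A. F x = f x))"

definition ultrahomogeneous :: "'a set \<Rightarrow> ('a \<Rightarrow> 'a \<Rightarrow> real) \<Rightarrow> bool"
  where "ultrahomogeneous M d \<longleftrightarrow> (\<forall>n\<ge>1. homogeneous n M d)"

definition isosceles_free :: "'a set \<Rightarrow> ('a \<Rightarrow> 'a \<Rightarrow> real) \<Rightarrow> bool"
  where "isosceles_free M d \<longleftrightarrow>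
    (\<forall>x\<in>M. \<forall>y\<in>M. \<forall>z\<in>M. x \<noteq> y \<and> x \<noteq> z \<and> y \<noteq> z \<longrightarrow> d x y \<noteq> d x z)"

end

theory Submission
  imports Defs
begin

text \<open>
  In an isosceles-free space a point is determined by its distance to any one fixed
  point, so an isometric embedding is determined by its value at a single point.
  Hence, given a partial isometry \<open>f\<close> with nonempty domain, it suffices to extend the
  restriction of \<open>f\<close> to one point \<open>a\<close>, which is what 1-homogeneity does: the resulting
  automorphism agrees with \<open>f\<close> at \<open>a\<close>, and therefore everywhere on the domain of \<open>f\<close>.
\<close>

lemma isosceles_free_dist_inj:
  assumes "Metric_space M d" "isosceles_free M d"
    and "x \<in> M" "y \<in> M" "z \<in> M" and eq: "d x y = d x z"
  shows "y = z"
proof -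
  interpret Metric_space M d by fact
  \<comment> \<open>Being isosceles-free says nothing when \<open>x\<close> is \<open>y\<close> or \<open>z\<close>; then the common distance is 0.\<close>
  show ?thesis
  proof (cases "x = y \<or> x = z")
    case True
    then show ?thesis
      using assms zero by metis
  next
    case False
    then show ?thesis
      using assms unfolding isosceles_free_def by metis
  qed
qed

lemma isosceles_free_isometric_eq:
  assumes "Metric_space M d" "isosceles_free M d"
    and f: "f ` A \<subseteq> M" "\<And>x y. x \<in> A \<Longrightarrow> y \<in> A \<Longrightarrow> d (f x) (f y) = e x y"
    and g: "g ` A \<subseteq> M" "\<And>x y. x \<in> A \<Longrightarrow> y \<in> A \<Longrightarrow> d (g x) (g y) = e x y"
    and "a \<in> A" "g a = f a" "x \<in> A"
  shows "g x = f x"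
proof (rule isosceles_free_dist_inj[OF assms(1,2)])
  show "f a \<in> M" "g x \<in> M" "f x \<in> M"
    using assms by auto
  show "d (f a) (g x) = d (f a) (f x)"
    using assms by metis
qed

lemma isometry_singleton:
  assumes "isometry A d B e f" "a \<in> A"
  shows "isometry {a} d {f a} e f"
  using assms by (auto simp: isometry_def)

theorem proposition3p4:
  fixes X :: "'a set" and d :: "'a \<Rightarrow> 'a \<Rightarrow> real"
  assumes "Metric_space X d"
    and "homogeneous 1 X d"
    and "isosceles_free X d"
  shows "ultrahomogeneous X d"
  unfolding ultrahomogeneous_def homogeneous_def
proof (intro allI impI, elim conjE)
  fix n :: nat and A B f
  assume A: "A \<subseteq> X" and B: "B \<subseteq> X" and f: "isometry A d B d f"
  have extend: "\<exists>F\<in>Aut X d. \<forall>x\<in>A'. F x = f x"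
    if "A' \<subseteq> X" "B' \<subseteq> X" "finite A'" "card A' \<le> 1" "isometry A' d B' d f" for A' B'
    using assms(2) that unfolding homogeneous_def by blast
  show "\<exists>F\<in>Aut X d. \<forall>x\<in>A. F x = f x"
  proof (cases "A = {}")
    case True
    then show ?thesis
      using extend[OF A B] f by simp
  next
    case False
    then obtain a where a: "a \<in> A" by blast
    have fA: "f ` A \<subseteq> X"
      using f B by (auto simp: isometry_def bij_betw_def)
    obtain F where F: "F \<in> Aut X d" and Fa: "F a = f a"
      using extend[of "{a}" "{f a}"] isometry_singleton[OF f a] a A fA by auto
    have FX: "isometry X d X d F"
      using F by (simp add: Aut_def)
    have "F x = f x" if "x \<in> A" for x
    proof (rule isosceles_free_isometric_eq[OF assms(1,3), where e = d and A = A and a = a and f = f and g = F])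
      show "F ` A \<subseteq> X"
        using FX A by (auto simp: isometry_def bij_betw_def)
      show "d (F x) (F y) = d x y" if "x \<in> A" "y \<in> A" for x y
        using FX A that by (auto simp: isometry_def)
      show "d (f x) (f y) = d x y" if "x \<in> A" "y \<in> A" for x y
        using f that by (auto simp: isometry_def)
    qed (use fA a Fa that in auto)
    then show ?thesis
      using F by blast
  qed
qed

end
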